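(* Let $(D,+,\cdot)$ be a distributive lattice and let $\{G_\alpha:\alpha\in D\}$ be a family of group semirings. Let $\{\phi_{\alpha,\beta}:G_\alpha\to G_\beta \text{ for } \beta\le\alpha\}$ be a family of isomorphisms satisfying the following: (SDL1) $\phi_{\alpha,\alpha}$ is the identity map on $G_\alpha$; (SDL2) if $\gamma\le\beta\le\alpha$ in $D$, then $\phi_{\alpha,\beta}\phi_{\beta,\gamma}=\phi_{\alpha,\gamma}$. Then $S=\bigcup_{\alpha\in D}G_\alpha$ is a semiring with product and sum defined as follows: for $x\in G_\alpha$ and $y\in G_\beta$, \[x\cdot y=x\phi_{\alpha,\alpha\beta}\cdot y\phi_{\beta,\alpha\beta}\] and \[x+y=x\psi_{\alpha,\alpha+\beta},\] where $\psi_{\beta,\alpha}=(\phi_{\alpha,\beta})^{-1}$ for $\beta\le\alpha$.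
   Context: Maps are written on the right of their arguments and composed left to right: $x(\phi\psi)=(x\phi)\psi$. In the definition of $x\cdot y$, the product on the right-hand side is taken in $G_{\alpha\beta}$. A semiring is a structure $(S,+,\cdot)$ where $(S,+)$ and $(S,\cdot)$ are semigroups and $x(y+z)=xy+xz$, $(x+y)z=xz+yz$ for all $x,y,z\in S$ (addition is not required to be commutative, and no zero or one is required). A group semiring is a semiring $(G,+,\cdot)$ where $(G,\cdot)$ is a group and addition is defined by $x+y=x$ for all $x,y\in G$. In a distributive lattice $(D,+,\cdot)$, $+$ denotes join, $\cdot$ denotes meet, and $\beta\le\alpha$ means $\alpha\beta=\beta$. *)

theory Defs
  imports "HOL-Algebra.Group" "HOL-Library.Disjoint_Sets"
begin

text \<open>
  Both the type class \<open>semiring\<close> and the locale \<open>semiring\<close> of HOL-Algebra have a commutative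
  addition, and the latter also has a zero and a one. None of this is wanted here, hence a
  record with just the two operations.
\<close>

record 'a bi_magma = "'a partial_object" +
  plus_of :: "'a \<Rightarrow> 'a \<Rightarrow> 'a"
  times_of :: "'a \<Rightarrow> 'a \<Rightarrow> 'a"

definition semigroup_on :: "'a set \<Rightarrow> ('a \<Rightarrow> 'a \<Rightarrow> 'a) \<Rightarrow> bool" where
  "semigroup_on A f \<longleftrightarrow>
     (\<forall>x\<in>A. \<forall>y\<in>A. f x y \<in> A) \<and>
     (\<forall>x\<in>A. \<forall>y\<in>A. \<forall>z\<in>A. f (f x y) z = f x (f y z))"

definition is_semiring :: "'a bi_magma \<Rightarrow> bool" where
  "is_semiring R \<longleftrightarrow>
     semigroup_on (carrier R) (plus_of R) \<and>
     semigroup_on (carrier R) (times_of R) \<and>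
     (\<forall>x\<in>carrier R. \<forall>y\<in>carrier R. \<forall>z\<in>carrier R.
        times_of R x (plus_of R y z) = plus_of R (times_of R x y) (times_of R x z) \<and>
        times_of R (plus_of R x y) z = plus_of R (times_of R x z) (times_of R y z))"

definition is_group_semiring :: "'a bi_magma \<Rightarrow> bool" where
  "is_group_semiring R \<longleftrightarrow>
     is_semiring R \<and>
     (\<exists>e. group \<lparr>carrier = carrier R, monoid.mult = times_of R, one = e\<rparr>) \<and>
     (\<forall>x\<in>carrier R. \<forall>y\<in>carrier R. plus_of R x y = x)"

definition semiring_iso :: "'a bi_magma \<Rightarrow> 'b bi_magma \<Rightarrow> ('a \<Rightarrow> 'b) set" where
  "semiring_iso R T =
     {h. bij_betw h (carrier R) (carrier T) \<and>
         (\<forall>x\<in>carrier R. \<forall>y\<in>carrier R.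
            h (plus_of R x y) = plus_of T (h x) (h y) \<and>
            h (times_of R x y) = times_of T (h x) (h y))}"

text \<open>
  In the following the distributive lattice is a type \<open>'d\<close>, with join \<open>sup\<close> and meet \<open>inf\<close>.
  The map from \<open>G \<alpha>\<close> to \<open>G \<beta>\<close>, for \<open>\<beta> \<le> \<alpha>\<close>, is \<open>\<phi> \<alpha> \<beta>\<close>; its values for other pairs of
  indices, and outside \<open>carrier (G \<alpha>)\<close>, are irrelevant. The index of \<open>x\<close> is unique because the
  \<open>G \<alpha>\<close> are pairwise disjoint, see \<open>index_of_eq\<close>, \<open>sdl_times\<close> and \<open>sdl_plus\<close> below.
\<close>

definition index_of :: "('d \<Rightarrow> 'a bi_magma) \<Rightarrow> 'a \<Rightarrow> 'd" where
  "index_of G x = (THE \<alpha>. x \<in> carrier (G \<alpha>))"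

text \<open>Note the order of the indices: for \<open>\<beta> \<le> \<alpha>\<close>, the map \<open>sdl_psi G \<phi> \<beta> \<alpha>\<close> goes from \<open>G \<beta>\<close> to \<open>G \<alpha>\<close>.\<close>

definition sdl_psi ::
  "('d \<Rightarrow> 'a bi_magma) \<Rightarrow> ('d \<Rightarrow> 'd \<Rightarrow> 'a \<Rightarrow> 'a) \<Rightarrow> 'd \<Rightarrow> 'd \<Rightarrow> 'a \<Rightarrow> 'a" where
  "sdl_psi G \<phi> \<beta> \<alpha> = inv_into (carrier (G \<alpha>)) (\<phi> \<alpha> \<beta>)"

definition sdl_union ::
  "('d::distrib_lattice \<Rightarrow> 'a bi_magma) \<Rightarrow> ('d \<Rightarrow> 'd \<Rightarrow> 'a \<Rightarrow> 'a) \<Rightarrow> 'a bi_magma" where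
  "sdl_union G \<phi> =
     \<lparr>carrier = (\<Union>\<alpha>. carrier (G \<alpha>)),
      plus_of = (\<lambda>x y. let \<alpha> = index_of G x; \<beta> = index_of G y
                       in sdl_psi G \<phi> \<alpha> (sup \<alpha> \<beta>) x),
      times_of = (\<lambda>x y. let \<alpha> = index_of G x; \<beta> = index_of G y
                        in times_of (G (inf \<alpha> \<beta>)) (\<phi> \<alpha> (inf \<alpha> \<beta>) x) (\<phi> \<beta> (inf \<alpha> \<beta>) y))\<rparr>"

lemma index_of_eq:
  assumes "disjoint_family (\<lambda>\<alpha>. carrier (G \<alpha>))" "x \<in> carrier (G \<alpha>)"
  shows "index_of G x = \<alpha>"
  unfolding index_of_def
  by (rule the_equality) (use assms in \<open>auto simp: disjoint_family_on_def\<close>)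

lemma sdl_times:
  assumes "disjoint_family (\<lambda>\<alpha>. carrier (G \<alpha>))" "x \<in> carrier (G \<alpha>)" "y \<in> carrier (G \<beta>)"
  shows "times_of (sdl_union G \<phi>) x y =
           times_of (G (inf \<alpha> \<beta>)) (\<phi> \<alpha> (inf \<alpha> \<beta>) x) (\<phi> \<beta> (inf \<alpha> \<beta>) y)"
  by (simp add: sdl_union_def Let_def index_of_eq[OF assms(1,2)] index_of_eq[OF assms(1,3)])

lemma sdl_plus:
  assumes "disjoint_family (\<lambda>\<alpha>. carrier (G \<alpha>))" "x \<in> carrier (G \<alpha>)" "y \<in> carrier (G \<beta>)"
  shows "plus_of (sdl_union G \<phi>) x y = sdl_psi G \<phi> \<alpha> (sup \<alpha> \<beta>) x"
  by (simp add: sdl_union_def Let_def index_of_eq[OF assms(1,2)] index_of_eq[OF assms(1,3)])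

end

theory Submission
  imports Defs
begin

text \<open>
  An element of \<open>S\<close> is determined by its index \<open>\<alpha>\<close> together with its image in \<open>G \<delta>\<close>, for any one
  \<open>\<delta> \<le> \<alpha>\<close>. In these coordinates the product is meet on indices and the product of \<open>G \<delta>\<close> on images,
  and the sum is join on indices and left projection on images. Taking \<open>\<delta>\<close> to be the meet of all
  indices involved, each semiring law splits into a law of distributive lattices and a law of the
  group semiring \<open>G \<delta>\<close>.
\<close>

locale sdl_system =
  fixes G :: "'d::distrib_lattice \<Rightarrow> 'a bi_magma"
    and \<phi> :: "'d \<Rightarrow> 'd \<Rightarrow> 'a \<Rightarrow> 'a"
  assumes disj: "disjoint_family (\<lambda>\<alpha>. carrier (G \<alpha>))"
    and grp: "\<And>\<alpha>. is_group_semiring (G \<alpha>)"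
    and iso: "\<And>\<alpha> \<beta>. \<beta> \<le> \<alpha> \<Longrightarrow> \<phi> \<alpha> \<beta> \<in> semiring_iso (G \<alpha>) (G \<beta>)"
    and SDL2: "\<And>\<alpha> \<beta> \<gamma> x. \<gamma> \<le> \<beta> \<Longrightarrow> \<beta> \<le> \<alpha> \<Longrightarrow> x \<in> carrier (G \<alpha>) \<Longrightarrow>
                 \<phi> \<beta> \<gamma> (\<phi> \<alpha> \<beta> x) = \<phi> \<alpha> \<gamma> x"
begin

abbreviation add (infixl "\<oplus>" 65) where "x \<oplus> y \<equiv> plus_of (sdl_union G \<phi>) x y"
abbreviation mul (infixl "\<odot>" 70) where "x \<odot> y \<equiv> times_of (sdl_union G \<phi>) x y"

lemma mul_fibre_closed:
  "x \<in> carrier (G \<alpha>) \<Longrightarrow> y \<in> carrier (G \<alpha>) \<Longrightarrow> times_of (G \<alpha>) x y \<in> carrier (G \<alpha>)"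
  using grp[of \<alpha>] by (auto simp: is_group_semiring_def is_semiring_def semigroup_on_def)

lemma mul_fibre_assoc:
  "x \<in> carrier (G \<alpha>) \<Longrightarrow> y \<in> carrier (G \<alpha>) \<Longrightarrow> z \<in> carrier (G \<alpha>) \<Longrightarrow>
   times_of (G \<alpha>) (times_of (G \<alpha>) x y) z = times_of (G \<alpha>) x (times_of (G \<alpha>) y z)"
  using grp[of \<alpha>] by (auto simp: is_group_semiring_def is_semiring_def semigroup_on_def)

lemma phi_bij: "\<beta> \<le> \<alpha> \<Longrightarrow> bij_betw (\<phi> \<alpha> \<beta>) (carrier (G \<alpha>)) (carrier (G \<beta>))"
  using iso[of \<beta> \<alpha>] by (auto simp: semiring_iso_def)

lemma phi_closed: "\<beta> \<le> \<alpha> \<Longrightarrow> x \<in> carrier (G \<alpha>) \<Longrightarrow> \<phi> \<alpha> \<beta> x \<in> carrier (G \<beta>)"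
  using phi_bij bij_betwE by blast

lemma phi_mult:
  "\<beta> \<le> \<alpha> \<Longrightarrow> x \<in> carrier (G \<alpha>) \<Longrightarrow> y \<in> carrier (G \<alpha>) \<Longrightarrow>
   \<phi> \<alpha> \<beta> (times_of (G \<alpha>) x y) = times_of (G \<beta>) (\<phi> \<alpha> \<beta> x) (\<phi> \<alpha> \<beta> y)"
  using iso[of \<beta> \<alpha>] by (auto simp: semiring_iso_def)

lemma mul_closed:
  assumes "x \<in> carrier (G \<alpha>)" "y \<in> carrier (G \<beta>)"
  shows "x \<odot> y \<in> carrier (G (inf \<alpha> \<beta>))"
  using assms by (simp add: sdl_times[OF disj assms] mul_fibre_closed phi_closed)

text \<open>The product is formed from images in the fibre at the meet. The homomorphism
  \<open>\<phi> (inf \<alpha> \<beta>) \<delta>\<close> distributes over it, and \<open>SDL2\<close>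
  then collapses each composite through the meet to the direct map down to \<delta>.\<close>

lemma phi_mul:
  assumes "x \<in> carrier (G \<alpha>)" "y \<in> carrier (G \<beta>)" "\<delta> \<le> \<alpha>" "\<delta> \<le> \<beta>"
  shows "\<phi> (inf \<alpha> \<beta>) \<delta> (x \<odot> y) = times_of (G \<delta>) (\<phi> \<alpha> \<delta> x) (\<phi> \<beta> \<delta> y)"
  using assms by (simp add: sdl_times[OF disj assms(1,2)] phi_mult phi_closed SDL2)

lemma add_closed:
  assumes "x \<in> carrier (G \<alpha>)" "y \<in> carrier (G \<beta>)"
  shows "x \<oplus> y \<in> carrier (G (sup \<alpha> \<beta>))"
  using bij_betwE[OF bij_betw_inv_into[OF phi_bij[of \<alpha> "sup \<alpha> \<beta>"]]] assms(1)
  by (simp add: sdl_plus[OF disj assms] sdl_psi_def)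

text \<open>The sum lifts \<open>x\<close> by the inverse of
  \<open>\<phi> (sup \<alpha> \<beta>) \<alpha>\<close>, so mapping back down to \<alpha> recovers
  \<open>x\<close>. By \<open>SDL2\<close> the map from the join to \<delta> passes through
  \<alpha>.\<close>

lemma phi_add:
  assumes "x \<in> carrier (G \<alpha>)" "y \<in> carrier (G \<beta>)" "\<delta> \<le> \<alpha>"
  shows "\<phi> (sup \<alpha> \<beta>) \<delta> (x \<oplus> y) = \<phi> \<alpha> \<delta> x"
proof -
  have "\<phi> (sup \<alpha> \<beta>) \<alpha> (x \<oplus> y) = x"
    using bij_betw_inv_into_right[OF phi_bij[of \<alpha> "sup \<alpha> \<beta>"]] assms(1)
    by (simp add: sdl_plus[OF disj assms(1,2)] sdl_psi_def)
  then show ?thesis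
    using SDL2[of \<delta> \<alpha> "sup \<alpha> \<beta>" "x \<oplus> y"] add_closed[OF assms(1,2)] assms(3) by simp
qed

text \<open>This is injectivity of \<open>\<phi> \<alpha> \<delta>\<close>. The two indices are kept
  apart because the sides of a law lie in fibres whose indices are different lattice terms; the
  premise \<open>\<alpha> = \<beta>\<close> then becomes a goal of its own.\<close>

lemma eq_by_image:
  assumes "x \<in> carrier (G \<alpha>)" "y \<in> carrier (G \<beta>)" "\<alpha> = \<beta>" "\<delta> \<le> \<alpha>" "\<phi> \<alpha> \<delta> x = \<phi> \<beta> \<delta> y"
  shows "x = y"
  using assms bij_betw_imp_inj_on[OF phi_bij[OF assms(4)]] by (auto dest: inj_onD)

lemma semiring_laws:
  assumes x: "x \<in> carrier (G \<alpha>)" and y: "y \<in> carrier (G \<beta>)" and z: "z \<in> carrier (G \<gamma>)"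
  shows add_assoc: "x \<oplus> y \<oplus> z = x \<oplus> (y \<oplus> z)"
    and mul_assoc: "x \<odot> y \<odot> z = x \<odot> (y \<odot> z)"
    and mul_add: "x \<odot> (y \<oplus> z) = x \<odot> y \<oplus> x \<odot> z"
    and add_mul: "(x \<oplus> y) \<odot> z = x \<odot> z \<oplus> y \<odot> z"
proof -
  \<comment> \<open>A common lower bound of the three indices, so all three elements have images in
    the single fibre \<open>G \<delta>\<close>.\<close>
  define \<delta> where "\<delta> = inf (inf \<alpha> \<beta>) \<gamma>"
  have le: "\<delta> \<le> \<alpha>" "\<delta> \<le> \<beta>" "\<delta> \<le> \<gamma>"
    by (auto simp: \<delta>_def intro: le_infI1 le_infI2)
  note closed = add_closed mul_closed x y z
  note image = phi_add phi_mul closed le le_supI1 mul_fibre_assoc phi_closed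
  \<comment> \<open>The rules \<open>closed\<close> compute the index of each side, so the remaining
    equation of indices is exactly a lattice law. Here both images in \<open>G \<delta>\<close> are
    the image of \<open>x\<close>.\<close>
  show "x \<oplus> y \<oplus> z = x \<oplus> (y \<oplus> z)"
    by (rule eq_by_image[where \<delta> = \<delta>], (rule closed)+, rule sup_assoc) (simp_all add: image)
  show "x \<odot> y \<odot> z = x \<odot> (y \<odot> z)"
    by (rule eq_by_image[where \<delta> = \<delta>], (rule closed)+, rule inf_assoc) (simp_all add: image)
  \<comment> \<open>Both images are the product of the images of \<open>x\<close> and
    \<open>y\<close>: left projection discards \<open>z\<close> on either side.\<close>
  show "x \<odot> (y \<oplus> z) = x \<odot> y \<oplus> x \<odot> z"
    by (rule eq_by_image[where \<delta> = \<delta>], (rule closed)+, rule inf_sup_distrib1) (simp_all add: image)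
  show "(x \<oplus> y) \<odot> z = x \<odot> z \<oplus> y \<odot> z"
    by (rule eq_by_image[where \<delta> = \<delta>], (rule closed)+, rule inf_sup_distrib2) (simp_all add: image)
qed

lemma is_semiring_sdl_union: "is_semiring (sdl_union G \<phi>)"
proof -
  have "carrier (sdl_union G \<phi>) = (\<Union>\<alpha>. carrier (G \<alpha>))"
    by (simp add: sdl_union_def)
  then show ?thesis
    unfolding is_semiring_def semigroup_on_def
    by (auto simp: semiring_laws intro: add_closed mul_closed)
qed

end

theorem theorem3p4:
  fixes G :: "'d::distrib_lattice \<Rightarrow> 'a bi_magma"
    and \<phi> :: "'d \<Rightarrow> 'd \<Rightarrow> 'a \<Rightarrow> 'a"
  assumes disj: "disjoint_family (\<lambda>\<alpha>. carrier (G \<alpha>))"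
    and grp: "\<And>\<alpha>. is_group_semiring (G \<alpha>)"
    and iso: "\<And>\<alpha> \<beta>. \<beta> \<le> \<alpha> \<Longrightarrow> \<phi> \<alpha> \<beta> \<in> semiring_iso (G \<alpha>) (G \<beta>)"
    and SDL1: "\<And>\<alpha> x. x \<in> carrier (G \<alpha>) \<Longrightarrow> \<phi> \<alpha> \<alpha> x = x"
    and SDL2: "\<And>\<alpha> \<beta> \<gamma> x. \<gamma> \<le> \<beta> \<Longrightarrow> \<beta> \<le> \<alpha> \<Longrightarrow> x \<in> carrier (G \<alpha>) \<Longrightarrow>
                 \<phi> \<beta> \<gamma> (\<phi> \<alpha> \<beta> x) = \<phi> \<alpha> \<gamma> x"
  shows "is_semiring (sdl_union G \<phi>)"
proof -
  interpret sdl_system G \<phi>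
    by unfold_locales (fact disj grp iso SDL2)+
  show ?thesis by (rule is_semiring_sdl_union)
qed

end
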